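(* Consider the NIRVAR model $\boldsymbol y^{(q)}=(X'\otimes I_N)R(A)\boldsymbol\gamma(A)+\mathbf u^{(q)}$, where $A\in\{0,1\}^{N\times NQ}$ specifies the true restrictions and $\boldsymbol\beta=R(A)\boldsymbol\gamma(A)$, and let $\hat A\in\{0,1\}^{N\times NQ}$ specify the estimated restrictions. Let $$\hat{\boldsymbol\gamma}(\hat A)=\{R(\hat A)'(XX'\otimes\Sigma^{-1})R(\hat A)\}^{-1}R(\hat A)'(X\otimes\Sigma^{-1})\boldsymbol y^{(q)},\qquad \hat{\boldsymbol\beta}(\hat A)=R(\hat A)\hat{\boldsymbol\gamma}(\hat A).$$ Conditional on the estimated restrictions $\hat A$, the NIRVAR estimator $\hat{\boldsymbol\beta}(\hat A)$ is unbiased (for $\boldsymbol\beta$) if and only if $\mathrm{colsp}\{R(A)\}\subseteq\mathrm{colsp}\{R(\hat A)\}$. When this condition is not satisfied, $$\mathbb E\{\hat{\boldsymbol\beta}(\hat A)\mid\hat A\}=R(\hat A)\,C\,\boldsymbol\gamma(A),$$ where $$C=\{R(\hat A)'(XX'\otimes\Sigma^{-1})R(\hat A)\}^{-1}R(\hat A)'(XX'\otimes\Sigma^{-1})R(A).$$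
   Context: Prime denotes transpose, $\mathrm{colsp}$ column space, $\mathrm{vec}$ column-stacking, $\otimes$ Kronecker product, $\odot$ Hadamard product, $|\cdot|_0$ number of nonzero entries. Fix $N,Q,T$ and a response feature $q\in\{1,\dots,Q\}$. NIRVAR model: $\boldsymbol X^{(q)}_t=\sum_{r=1}^Q (A^{(r)}\odot\tilde\Phi^{(r)})\boldsymbol X^{(r)}_{t-1}+\boldsymbol\epsilon^{(q)}_t\in\mathbb R^N$, a zero-mean second-order stationary process, with $A^{(r)}\in\{0,1\}^{N\times N}$ (a realisation of) the adjacency matrix of a stochastic block model (treated as given) and $\tilde\Phi^{(r)}$ fixed $N\times N$ weight matrices (both may depend on $q$, suppressed in the notation). Put $\Phi^{(r)}=A^{(r)}\odot\tilde\Phi^{(r)}$, $\Phi=(\Phi^{(1)}|\cdots|\Phi^{(Q)})$ and $A=(A^{(1)}|\cdots|A^{(Q)})\in\{0,1\}^{N\times NQ}$ (column-wise concatenation). Every feature follows such an equation, so the stacked vector $\boldsymbol X_t=(\boldsymbol X_t^{(1)\prime},\dots,\boldsymbol X_t^{(Q)\prime})'\in\mathbb R^{NQ}$ is a VAR(1), assumed stable (coefficient matrix with spectral radius less than $1$) and stationary. The noise is white noise: $\boldsymbol\epsilon^{(q)}_t$ are continuous random vectors with $\mathbb E\boldsymbol\epsilon^{(q)}_t=0$, $\Sigma=\mathbb E\{\boldsymbol\epsilon^{(q)}_t\boldsymbol\epsilon^{(q)\prime}_t\}$ nonsingular, $\boldsymbol\epsilon^{(q)}_t$ and $\boldsymbol\epsilon^{(r)}_s$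 independent for $t\ne s$ and $q\neq r$, and fourth-order moments $\mathbb E|\epsilon^{(q)}_{i,t}\epsilon^{(q)}_{j,t}\epsilon^{(q)}_{l,t}\epsilon^{(q)}_{m,t}|\le c<\infty$. Data matrices: $Y^{(q)}=(\boldsymbol X^{(q)}_1,\dots,\boldsymbol X^{(q)}_T)$, $X=(\boldsymbol X_0,\dots,\boldsymbol X_{T-1})$, $U^{(q)}=(\boldsymbol\epsilon^{(q)}_1,\dots,\boldsymbol\epsilon^{(q)}_T)$, $\boldsymbol y^{(q)}=\mathrm{vec}(Y^{(q)})$, $\mathbf u^{(q)}=\mathrm{vec}(U^{(q)})$, $\boldsymbol\beta=\mathrm{vec}(\Phi)$. Restriction matrices: for a binary matrix $B\in\{0,1\}^{N\times NQ}$ with $M_B=|B|_0$, $R(B)\in\{0,1\}^{N^2Q\times M_B}$ is defined by $[R(B)]_{ij}=\mathrm{vec}(B)_i\,\mathbf 1\{\sum_{k=1}^{i-1}\mathrm{vec}(B)_k=j-1\}$, and $\boldsymbol\gamma(B)\in\mathbb R^{M_B}$ is the vector of those entries $\beta_i$ with $\mathrm{vec}(B)_i\ne0$ (in order). Thus $\boldsymbol\beta=R(A)\boldsymbol\gamma(A)$. The matrices inverted are assumed invertible.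
   Formalization: The expectation is over the noise only, with X held at an observed value; E{u|Â}=0 is assumed; unbiased means for every γ, or at the true β when γ(A) has no zero entries. As literally stated the claim fails (autoregressive small-sample bias, Â depending on the noise, γ=0). *)

theory Defs
  imports
    "HOL-Probability.Probability"
    "Jordan_Normal_Form.Spectral_Radius"
    "Jordan_Normal_Form.Gauss_Jordan_Elimination"
    "Jordan_Normal_Form.VS_Connect"
begin

(* Vectors and matrices are those of Jordan_Normal_Form throughout, since the number of columns
   of a restriction matrix depends on the restriction. *)
unbundle no vec_syntax
no_notation inner (infix "\<bullet>" 70)
hide_type (open) Finite_Cartesian_Product.vec
hide_const (open) Finite_Cartesian_Product.vec Finite_Cartesian_Product.mat

text \<open>All indices (features, coordinates, matrix entries) are 0-based.\<close>

definition hadamard :: "real mat \<Rightarrow> real mat \<Rightarrow> real mat" (infixl \<open>\<odot>\<close> 70) where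
  "A \<odot> B = mat (dim_row A) (dim_col A) (\<lambda>ij. A $$ ij * B $$ ij)"

definition kron :: "real mat \<Rightarrow> real mat \<Rightarrow> real mat" (infixl \<open>\<otimes>\<^sub>K\<close> 70) where
  "A \<otimes>\<^sub>K B = mat (dim_row A * dim_row B) (dim_col A * dim_col B)
     (\<lambda>(i,j). A $$ (i div dim_row B, j div dim_col B) * B $$ (i mod dim_row B, j mod dim_col B))"

text \<open>Column stacking (the operator usually written vec).\<close>
definition colvec :: "real mat \<Rightarrow> real vec" where
  "colvec A = vec (dim_row A * dim_col A) (\<lambda>i. A $$ (i mod dim_row A, i div dim_row A))"

text \<open>Column-wise concatenation $(F_0 | \cdots | F_{Q-1})$ of $N \times N$ blocks.\<close>
definition hconcat :: "nat \<Rightarrow> nat \<Rightarrow> (nat \<Rightarrow> real mat) \<Rightarrow> real mat" where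
  "hconcat N Q F = mat N (N * Q) (\<lambda>(i,j). F (j div N) $$ (i, j mod N))"

definition nnz :: "real mat \<Rightarrow> nat" where
  "nnz B = card {(i,j). i < dim_row B \<and> j < dim_col B \<and> B $$ (i,j) \<noteq> 0}"

definition binary_mats :: "nat \<Rightarrow> nat \<Rightarrow> real mat set" where
  "binary_mats m n = {B \<in> carrier_mat m n. \<forall>i<m. \<forall>j<n. B $$ (i,j) \<in> {0,1}}"

text \<open>Inverse of a matrix; only meaningful if the matrix is invertible.\<close>
definition minv :: "real mat \<Rightarrow> real mat" where
  "minv A = the (mat_inverse A)"

abbreviation colsp :: "real mat \<Rightarrow> real vec set" where
  "colsp A \<equiv> vec_space.col_space (dim_row A) A"

text \<open>The restriction matrix $R(B)$ and the vector of unrestricted entries of \<open>b\<close>.\<close>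

definition restr :: "real mat \<Rightarrow> real mat" where
  "restr B = mat (dim_row B * dim_col B) (nnz B)
     (\<lambda>(i,j). colvec B $ i * (if (\<Sum>k<i. colvec B $ k) = real j then 1 else 0))"

definition unrestr :: "real mat \<Rightarrow> real vec \<Rightarrow> real vec" where
  "unrestr B b = vec_of_list (map (\<lambda>i. b $ i)
     (filter (\<lambda>i. colvec B $ i \<noteq> 0) [0..<dim_vec (colvec B)]))"

text \<open>The NIRVAR model. \<open>A r s\<close> and \<open>W r s\<close> are the adjacency and weight matrix with which
  feature \<open>s\<close> enters the equation of feature \<open>r\<close>; \<open>X t r\<close> and \<open>\<epsilon> t r\<close> are the observations and the
  noise of feature \<open>r\<close> at time \<open>t\<close>. The adjacency matrices are given realisations, so nothing of
  the stochastic block model remains beyond their being binary.\<close>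

definition Phi_block :: "(nat \<Rightarrow> nat \<Rightarrow> real mat) \<Rightarrow> (nat \<Rightarrow> nat \<Rightarrow> real mat) \<Rightarrow> nat \<Rightarrow> nat \<Rightarrow> real mat" where
  "Phi_block A W r s = A r s \<odot> W r s"

definition var_coeff ::
  "nat \<Rightarrow> nat \<Rightarrow> (nat \<Rightarrow> nat \<Rightarrow> real mat) \<Rightarrow> (nat \<Rightarrow> nat \<Rightarrow> real mat) \<Rightarrow> real mat" where
  "var_coeff N Q A W = mat (N * Q) (N * Q)
     (\<lambda>(i,j). Phi_block A W (i div N) (j div N) $$ (i mod N, j mod N))"

locale nirvar = prob_space M for M :: "'a measure" +
  fixes N Q :: nat
    and A W :: "nat \<Rightarrow> nat \<Rightarrow> real mat"
    and X \<epsilon> :: "int \<Rightarrow> nat \<Rightarrow> 'a \<Rightarrow> real vec"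
    and \<Sigma> :: "nat \<Rightarrow> real mat"
  assumes N_pos: "0 < N"
    and A_binary: "\<lbrakk>r < Q; s < Q\<rbrakk> \<Longrightarrow> A r s \<in> binary_mats N N"
    and W_carrier: "\<lbrakk>r < Q; s < Q\<rbrakk> \<Longrightarrow> W r s \<in> carrier_mat N N"
    and X_carrier: "\<lbrakk>r < Q; \<omega> \<in> space M\<rbrakk> \<Longrightarrow> X t r \<omega> \<in> carrier_vec N"
    and eps_carrier: "\<lbrakk>r < Q; \<omega> \<in> space M\<rbrakk> \<Longrightarrow> \<epsilon> t r \<omega> \<in> carrier_vec N"
    and var_eq: "r < Q \<Longrightarrow> AE \<omega> in M. \<forall>i<N.
          X t r \<omega> $ i = (\<Sum>s<Q. (Phi_block A W r s *\<^sub>v X (t - 1) s \<omega>) $ i) + \<epsilon> t r \<omega> $ i"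
    and stable: "spectral_radius (map_mat complex_of_real (var_coeff N Q A W)) < 1"
    and X_measurable: "\<lbrakk>r < Q; i < N\<rbrakk> \<Longrightarrow> random_variable borel (\<lambda>\<omega>. X t r \<omega> $ i)"
    and X_square_integrable: "\<lbrakk>r < Q; i < N\<rbrakk> \<Longrightarrow> integrable M (\<lambda>\<omega>. (X t r \<omega> $ i)\<^sup>2)"
    and X_mean: "\<lbrakk>r < Q; i < N\<rbrakk> \<Longrightarrow> expectation (\<lambda>\<omega>. X t r \<omega> $ i) = 0"
    and X_stationary: "\<lbrakk>r < Q; s < Q; i < N; j < N\<rbrakk> \<Longrightarrow>
          expectation (\<lambda>\<omega>. X (t + h) r \<omega> $ i * X t s \<omega> $ j)
        = expectation (\<lambda>\<omega>. X h r \<omega> $ i * X 0 s \<omega> $ j)"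
    and eps_continuous: "r < Q \<Longrightarrow>
          \<exists>f. distributed M (Pi\<^sub>M {..<N} (\<lambda>_. lborel)) (\<lambda>\<omega>. \<lambda>i\<in>{..<N}. \<epsilon> t r \<omega> $ i) f"
    and eps_fourth_moments: "r < Q \<Longrightarrow> \<exists>c. \<forall>t. \<forall>i<N. \<forall>j<N. \<forall>l<N. \<forall>m<N.
          integrable M (\<lambda>\<omega>. \<bar>\<epsilon> t r \<omega> $ i * \<epsilon> t r \<omega> $ j * \<epsilon> t r \<omega> $ l * \<epsilon> t r \<omega> $ m\<bar>) \<and>
          expectation (\<lambda>\<omega>. \<bar>\<epsilon> t r \<omega> $ i * \<epsilon> t r \<omega> $ j * \<epsilon> t r \<omega> $ l * \<epsilon> t r \<omega> $ m\<bar>) \<le> c"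
    and eps_mean: "\<lbrakk>r < Q; i < N\<rbrakk> \<Longrightarrow> expectation (\<lambda>\<omega>. \<epsilon> t r \<omega> $ i) = 0"
    and Sigma_carrier: "r < Q \<Longrightarrow> \<Sigma> r \<in> carrier_mat N N"
    and eps_cov: "\<lbrakk>r < Q; i < N; j < N\<rbrakk> \<Longrightarrow>
          expectation (\<lambda>\<omega>. \<epsilon> t r \<omega> $ i * \<epsilon> t r \<omega> $ j) = \<Sigma> r $$ (i,j)"
    and Sigma_nonsingular: "r < Q \<Longrightarrow> invertible_mat (\<Sigma> r)"
    and eps_white: "\<lbrakk>r < Q; i < N; j < N; t \<noteq> t'\<rbrakk> \<Longrightarrow>
          expectation (\<lambda>\<omega>. \<epsilon> t r \<omega> $ i * \<epsilon> t' r \<omega> $ j) = 0"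
    (* Independence is required only when time and feature both differ; the common stronger
       requirement (one of them differs) is covered a fortiori. *)
    and eps_indep: "\<lbrakk>r < Q; s < Q; r \<noteq> s; t \<noteq> t'\<rbrakk> \<Longrightarrow>
          indep_var (Pi\<^sub>M {..<N} (\<lambda>_. borel)) (\<lambda>\<omega>. \<lambda>i\<in>{..<N}. \<epsilon> t r \<omega> $ i)
                    (Pi\<^sub>M {..<N} (\<lambda>_. borel)) (\<lambda>\<omega>. \<lambda>i\<in>{..<N}. \<epsilon> t' s \<omega> $ i)"

text \<open>Data matrices for an outcome \<open>\<omega>\<close>: the regressors $X = (X_0, \ldots, X_{T-1})$ of the stacked
  process, and $(Z_1, \ldots, Z_T)$ for \<open>Z\<close> the observations or the noise of one feature.\<close>

definition design :: "nat \<Rightarrow> nat \<Rightarrow> nat \<Rightarrow> (int \<Rightarrow> nat \<Rightarrow> 'a \<Rightarrow> real vec) \<Rightarrow> 'a \<Rightarrow> real mat" where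
  "design N Q T X \<omega> = mat (N * Q) T (\<lambda>(i,t). X (int t) (i div N) \<omega> $ (i mod N))"

definition data_mat :: "nat \<Rightarrow> nat \<Rightarrow> (int \<Rightarrow> nat \<Rightarrow> 'a \<Rightarrow> real vec) \<Rightarrow> nat \<Rightarrow> 'a \<Rightarrow> real mat" where
  "data_mat N T Z q \<omega> = mat N T (\<lambda>(i,t). Z (int t + 1) q \<omega> $ i)"

text \<open>Response of the regression with regressors \<open>x\<close>, restrictions \<open>B\<close>, parameter \<open>g\<close> and noise
  \<open>u\<close>. The process satisfies it with \<open>x\<close> the design matrix (lemma \<open>regression_form\<close> below). The
  expectation of the estimator is the fixed-design one of generalised least squares: \<open>x\<close> is held
  at an observed value \<open>design N Q T X \<omega>\<^sub>0\<close> and only the noise is averaged. Integrating over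
  the lagged regressors as well would not give a formula in which \<open>x\<close> still occurs, and by the
  usual small-sample bias of autoregressions least squares is then not unbiased even without
  misspecified restrictions.\<close>
definition regr :: "nat \<Rightarrow> real mat \<Rightarrow> real mat \<Rightarrow> real vec \<Rightarrow> real vec \<Rightarrow> real vec" where
  "regr N x B g u = (x\<^sup>T \<otimes>\<^sub>K 1\<^sub>m N) *\<^sub>v (restr B *\<^sub>v g) + u"

text \<open>The generalised least squares estimator, with \<open>S\<close> the noise covariance matrix.\<close>

definition gram :: "real mat \<Rightarrow> real mat \<Rightarrow> real mat \<Rightarrow> real mat" where
  "gram S x B = (restr B)\<^sup>T * ((x * x\<^sup>T) \<otimes>\<^sub>K minv S) * restr B"

definition gamma_hat :: "real mat \<Rightarrow> real mat \<Rightarrow> real mat \<Rightarrow> real vec \<Rightarrow> real vec" where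
  "gamma_hat S x B y = minv (gram S x B) *\<^sub>v ((restr B)\<^sup>T *\<^sub>v ((x \<otimes>\<^sub>K minv S) *\<^sub>v y))"

definition beta_hat :: "real mat \<Rightarrow> real mat \<Rightarrow> real mat \<Rightarrow> real vec \<Rightarrow> real vec" where
  "beta_hat S x B y = restr B *\<^sub>v gamma_hat S x B y"

definition C_mat :: "real mat \<Rightarrow> real mat \<Rightarrow> real mat \<Rightarrow> real mat \<Rightarrow> real mat" where
  "C_mat S x A B = minv (gram S x B) * ((restr B)\<^sup>T * ((x * x\<^sup>T) \<otimes>\<^sub>K minv S) * restr A)"

text \<open>Conditional expectation, entry by entry, of an \<open>n\<close>-dimensional random vector \<open>Z\<close> given a
  random matrix \<open>H\<close> with values in \<open>\<B>\<close>. With \<open>H\<close> the estimated restrictions, exogeneity of the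
  noise means that its conditional mean given \<open>H\<close> vanishes; for a constant \<open>H\<close> this is just
  \<open>eps_mean\<close>.\<close>
definition cond_exp_vec ::
  "'a measure \<Rightarrow> real mat set \<Rightarrow> ('a \<Rightarrow> real mat) \<Rightarrow> nat \<Rightarrow> ('a \<Rightarrow> real vec) \<Rightarrow> 'a \<Rightarrow> real vec" where
  "cond_exp_vec M \<B> H n Z \<omega> =
     vec n (\<lambda>i. real_cond_exp M (vimage_algebra (space M) H (count_space \<B>)) (\<lambda>\<omega>. Z \<omega> $ i) \<omega>)"

lemma sum_lessThan_add:
  fixes f :: "nat \<Rightarrow> real"
  shows "(\<Sum>l<a + b. f l) = (\<Sum>l<a. f l) + (\<Sum>i<b. f (a + i))"
  by (induction b) (auto simp: ac_simps)

lemma sum_lessThan_mult: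
  fixes f :: "nat \<Rightarrow> real"
  shows "(\<Sum>l<J * n. f l) = (\<Sum>j<J. \<Sum>i<n. f (j * n + i))"
proof (induction J)
  case (Suc J)
  have "(\<Sum>l<Suc J * n. f l) = (\<Sum>l<J * n + n. f l)" by (simp add: add.commute)
  then show ?case by (simp only: sum_lessThan_add Suc.IH sum.lessThan_Suc)
qed simp

lemma filter_upt_nth_card:
  assumes "i < n" "P i"
  shows "filter P [0..<n] ! card {k. k < i \<and> P k} = i"
    and "card {k. k < i \<and> P k} < length (filter P [0..<n])"
proof -
  have "[0..<n] = [0..<i] @ i # [Suc i..<n]"
    using upt_add_eq_append[of 0 i "n - i"] upt_conv_Cons[of i n] assms(1) by simp
  moreover have "length (filter P [0..<i]) = card {k. k < i \<and> P k}"
    by (simp add: length_filter_conv_card cong: conj_cong)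
  ultimately show "filter P [0..<n] ! card {k. k < i \<and> P k} = i"
    and "card {k. k < i \<and> P k} < length (filter P [0..<n])"
    using assms(2) by (auto simp: nth_append)
qed

lemma nnz_eq_length:
  "nnz B = length (filter (\<lambda>i. colvec B $ i \<noteq> 0) [0..<dim_vec (colvec B)])"
proof -
  let ?m = "dim_row B" and ?n = "dim_col B"
  let ?S = "{(i,j). i < ?m \<and> j < ?n \<and> B $$ (i,j) \<noteq> 0}"
  let ?T = "{k. k < ?m * ?n \<and> B $$ (k mod ?m, k div ?m) \<noteq> 0}"
  have *: "j * ?m + i < ?m * ?n" if "i < ?m" "j < ?n" for i j
  proof -
    have "j * ?m + i < Suc j * ?m" using that by simp
    also have "\<dots> \<le> ?n * ?m" using that by (intro mult_right_mono) auto
    finally show ?thesis by (simp add: mult.commute)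
  qed
  have **: "k mod ?m < ?m" "k div ?m < ?n" if "k < ?m * ?n" for k
  proof -
    have "?m > 0" using that by (cases "?m") auto
    then show "k mod ?m < ?m" by simp
    show "k div ?m < ?n" using that by (simp add: less_mult_imp_div_less mult.commute)
  qed
  have "bij_betw (\<lambda>(i,j). j * ?m + i) ?S ?T"
    by (rule bij_betw_byWitness[where f' = "\<lambda>k. (k mod ?m, k div ?m)"])
       (auto simp: * **)
  then have "card ?S = card ?T" by (rule bij_betw_same_card)
  also have "\<dots> = card {k. k < ?m * ?n \<and> colvec B $ k \<noteq> 0}"
    by (rule arg_cong[where f = card]) (auto simp: colvec_def)
  finally show ?thesis
    by (simp add: nnz_def length_filter_conv_card colvec_def cong: conj_cong)
qed

lemma restr_unrestr:
  assumes B: "B \<in> binary_mats m n" and b: "b \<in> carrier_vec (m * n)"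
    and supp: "\<And>i. i < m * n \<Longrightarrow> colvec B $ i = 0 \<Longrightarrow> b $ i = 0"
  shows "restr B *\<^sub>v unrestr B b = b"
proof (rule eq_vecI)
  have dims: "dim_row B = m" "dim_col B = n" using B by (auto simp: binary_mats_def)
  show "dim_vec (restr B *\<^sub>v unrestr B b) = dim_vec b" using b dims by (simp add: restr_def)
  have du: "dim_vec (unrestr B b) = nnz B" by (simp add: unrestr_def nnz_eq_length)
  have bin: "colvec B $ i \<in> {0,1}" if "i < m * n" for i
  proof -
    have "m > 0" using that by (cases m) auto
    then have "i mod m < m" "i div m < n" using that by (auto simp: less_mult_imp_div_less mult.commute)
    then show ?thesis using B that dims by (auto simp: colvec_def binary_mats_def)
  qed
  fix i assume "i < dim_vec b"
  then have i: "i < m * n" using b by auto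
  define c where "c = card {k. k < i \<and> colvec B $ k \<noteq> 0}"
  have "(\<Sum>k<i. colvec B $ k) = (\<Sum>k<i. if colvec B $ k \<noteq> 0 then 1 else 0)"
  proof (intro sum.cong refl)
    fix k assume "k \<in> {..<i}"
    then have "colvec B $ k \<in> {0,1}" using i by (intro bin) simp
    then show "colvec B $ k = (if colvec B $ k \<noteq> 0 then 1 else 0)" by auto
  qed
  also have "\<dots> = real c" by (simp add: c_def sum.If_cases Int_def)
  finally have sc: "(\<Sum>k<i. colvec B $ k) = real c" .
  have "(restr B *\<^sub>v unrestr B b) $ i
      = (\<Sum>j<nnz B. colvec B $ i * (if c = j then 1 else 0) * unrestr B b $ j)"
    using i dims by (simp add: restr_def scalar_prod_def du sc[unfolded lessThan_atLeast0] lessThan_atLeast0)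
  also have "\<dots> = b $ i"
  proof (cases "colvec B $ i = 0")
    case True
    then show ?thesis using supp[OF i] by simp
  next
    case False
    have dv: "dim_vec (colvec B) = m * n" using dims by (simp add: colvec_def)
    have "c < nnz B" and fc: "filter (\<lambda>i. colvec B $ i \<noteq> 0) [0..<m * n] ! c = i"
      using filter_upt_nth_card[OF i, of "\<lambda>i. colvec B $ i \<noteq> 0"] False
      by (simp_all add: c_def nnz_eq_length dv)
    then have "unrestr B b $ c = b $ i"
      by (simp add: unrestr_def dv nnz_eq_length vec_of_list_index)
    moreover have "colvec B $ i = 1" using False bin[OF i] by simp
    moreover have "(\<Sum>j<nnz B. colvec B $ i * (if c = j then 1 else 0) * unrestr B b $ j)
        = (\<Sum>j<nnz B. if c = j then colvec B $ i * unrestr B b $ j else 0)"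
      by (intro sum.cong) auto
    ultimately show ?thesis using \<open>c < nnz B\<close> by simp
  qed
  finally show "(restr B *\<^sub>v unrestr B b) $ i = b $ i" .
qed

lemma (in nirvar) beta_restricted:
  assumes q: "q < Q"
  shows "restr (hconcat N Q (A q)) *\<^sub>v
           unrestr (hconcat N Q (A q)) (colvec (hconcat N Q (Phi_block A W q)))
       = colvec (hconcat N Q (Phi_block A W q))"
proof (rule restr_unrestr)
  have blk: "j div N < Q" "j mod N < N" if "j < N * Q" for j
    using that N_pos by (auto simp: less_mult_imp_div_less mult.commute)
  show "hconcat N Q (A q) \<in> binary_mats N (N * Q)"
    using A_binary[OF q] blk by (auto simp: hconcat_def binary_mats_def)
  show "colvec (hconcat N Q (Phi_block A W q)) \<in> carrier_vec (N * (N * Q))"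
    by (intro carrier_vecI) (simp add: colvec_def hconcat_def)
  fix i assume i: "i < N * (N * Q)" and z: "colvec (hconcat N Q (A q)) $ i = 0"
  have im: "i mod N < N" using N_pos by simp
  have id: "i div N < N * Q" using i by (intro less_mult_imp_div_less) (simp add: mult.commute)
  have "A q (i div N div N) $$ (i mod N, i div N mod N) = 0"
    using z i im id by (simp add: colvec_def hconcat_def)
  moreover have "A q (i div N div N) \<in> carrier_mat N N"
    using A_binary[OF q blk(1)[OF id]] by (simp add: binary_mats_def)
  ultimately show "colvec (hconcat N Q (Phi_block A W q)) $ i = 0"
    using i im id blk(2)[OF id] by (simp add: colvec_def hconcat_def Phi_block_def hadamard_def)
qed

lemma (in nirvar) regression_form:
  assumes q: "q < Q"
  defines "Aq \<equiv> hconcat N Q (A q)"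
  shows "AE \<omega> in M. colvec (data_mat N T X q \<omega>)
      = regr N (design N Q T X \<omega>) Aq (unrestr Aq (colvec (hconcat N Q (Phi_block A W q))))
          (colvec (data_mat N T \<epsilon> q \<omega>))"
proof -
  let ?F = "hconcat N Q (Phi_block A W q)"
  have blk: "j div N < Q" "j mod N < N" if "j < N * Q" for j
    using that N_pos by (auto simp: less_mult_imp_div_less mult.commute)
  have "AE \<omega> in M. \<forall>t::nat. \<forall>i<N. X (int t + 1) q \<omega> $ i =
      (\<Sum>s<Q. (Phi_block A W q s *\<^sub>v X (int t) s \<omega>) $ i) + \<epsilon> (int t + 1) q \<omega> $ i"
  proof (subst AE_all_countable, rule allI)
    fix t :: nat
    show "AE \<omega> in M. \<forall>i<N. X (int t + 1) q \<omega> $ i =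
      (\<Sum>s<Q. (Phi_block A W q s *\<^sub>v X (int t) s \<omega>) $ i) + \<epsilon> (int t + 1) q \<omega> $ i"
      using var_eq[OF q, of "int t + 1"] by simp
  qed
  moreover have "AE \<omega> in M. \<omega> \<in> space M" by simp
  ultimately show ?thesis
  proof eventually_elim
    case (elim \<omega>)
    let ?x = "design N Q T X \<omega>"
    have dF: "dim_row ?F = N" "dim_col ?F = N * Q" by (simp_all add: hconcat_def)
    have key: "((?x\<^sup>T \<otimes>\<^sub>K 1\<^sub>m N) *\<^sub>v colvec ?F) $ k
        = (\<Sum>s<Q. (Phi_block A W q s *\<^sub>v X (int (k div N)) s \<omega>) $ (k mod N))"
      if k: "k < N * T" for k
    proof -
      have kb: "k mod N < N" "k div N < T"
        using k N_pos by (auto simp: less_mult_imp_div_less mult.commute)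
      have "((?x\<^sup>T \<otimes>\<^sub>K 1\<^sub>m N) *\<^sub>v colvec ?F) $ k = (\<Sum>l<N * Q * N.
          ?x $$ (l div N, k div N) * (if k mod N = l mod N then 1 else 0)
          * ?F $$ (l mod N, l div N))"
      proof -
        have dx: "dim_row ?x = N * Q" "dim_col ?x = T" by (simp_all add: design_def)
        have k': "k < T * N" using k by (simp add: mult.commute)
        have "((?x\<^sup>T \<otimes>\<^sub>K 1\<^sub>m N) *\<^sub>v colvec ?F) $ k
            = (\<Sum>l<N * Q * N. (?x\<^sup>T \<otimes>\<^sub>K 1\<^sub>m N) $$ (k, l) * colvec ?F $ l)"
          using k' by (simp add: kron_def scalar_prod_def colvec_def dF dx lessThan_atLeast0
              mult.commute[of N "N * Q"])
        also have "\<dots> = (\<Sum>l<N * Q * N. ?x $$ (l div N, k div N)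
            * (if k mod N = l mod N then 1 else 0) * ?F $$ (l mod N, l div N))"
        proof (intro sum.cong refl)
          fix l assume "l \<in> {..<N * Q * N}"
          then have l: "l < N * Q * N" by simp
          then have "l mod N < N" "l div N < N * Q"
            using N_pos by (auto intro: less_mult_imp_div_less)
          then show "(?x\<^sup>T \<otimes>\<^sub>K 1\<^sub>m N) $$ (k, l) * colvec ?F $ l = ?x $$ (l div N, k div N)
              * (if k mod N = l mod N then 1 else 0) * ?F $$ (l mod N, l div N)"
            using l k' kb by (simp add: kron_def colvec_def dF dx mult.commute[of N "N * Q"])
        qed
        finally show ?thesis .
      qed
      also have "\<dots> = (\<Sum>j<N * Q. \<Sum>i<N. ?x $$ (j, k div N)
          * (if k mod N = i then 1 else 0) * ?F $$ (i, j))"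
        unfolding sum_lessThan_mult by (intro sum.cong refl) simp
      also have "\<dots> = (\<Sum>j<N * Q. ?x $$ (j, k div N) * ?F $$ (k mod N, j))"
      proof (intro sum.cong refl)
        fix j
        have "(\<Sum>i<N. ?x $$ (j, k div N) * (if k mod N = i then 1 else 0) * ?F $$ (i, j))
            = (\<Sum>i<N. if k mod N = i then ?x $$ (j, k div N) * ?F $$ (i, j) else 0)"
          by (intro sum.cong) auto
        then show "(\<Sum>i<N. ?x $$ (j, k div N) * (if k mod N = i then 1 else 0) * ?F $$ (i, j))
            = ?x $$ (j, k div N) * ?F $$ (k mod N, j)"
          using kb by simp
      qed
      also have "\<dots> = (\<Sum>s<Q. \<Sum>i<N. ?x $$ (s * N + i, k div N) * ?F $$ (k mod N, s * N + i))"
        unfolding mult.commute[of N Q] sum_lessThan_mult ..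
      also have "\<dots> = (\<Sum>s<Q. (Phi_block A W q s *\<^sub>v X (int (k div N)) s \<omega>) $ (k mod N))"
      proof (intro sum.cong refl)
        fix s assume "s \<in> {..<Q}"
        then have s: "s < Q" by simp
        have P: "dim_row (Phi_block A W q s) = N" "dim_col (Phi_block A W q s) = N"
          using A_binary[OF q s] by (auto simp: Phi_block_def hadamard_def binary_mats_def)
        have Xd: "dim_vec (X (int (k div N)) s \<omega>) = N"
          using X_carrier[OF s elim(2)] by auto
        have idx: "s * N + i < N * Q" if "i < N" for i
        proof -
          have "s * N + i < Suc s * N" using that by simp
          also have "\<dots> \<le> Q * N" using s by (intro mult_right_mono) auto
          finally show ?thesis by (simp add: mult.commute)
        qed
        show "(\<Sum>i<N. ?x $$ (s * N + i, k div N) * ?F $$ (k mod N, s * N + i))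
            = (Phi_block A W q s *\<^sub>v X (int (k div N)) s \<omega>) $ (k mod N)"
          using kb idx
          by (simp add: scalar_prod_def P Xd design_def hconcat_def lessThan_atLeast0 mult.commute)
      qed
      finally show ?thesis .
    qed
    show ?case
      unfolding Aq_def regr_def beta_restricted[OF q]
    proof (rule eq_vecI)
      have dU: "dim_vec (colvec (data_mat N T \<epsilon> q \<omega>)) = N * T"
        by (simp add: colvec_def data_mat_def)
      fix k assume "k < dim_vec ((?x\<^sup>T \<otimes>\<^sub>K 1\<^sub>m N) *\<^sub>v colvec ?F + colvec (data_mat N T \<epsilon> q \<omega>))"
      then have k: "k < N * T" by (simp add: colvec_def data_mat_def)
      have kb: "k mod N < N" "k div N < T"
        using k N_pos by (auto simp: less_mult_imp_div_less mult.commute)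
      have "colvec (data_mat N T X q \<omega>) $ k = X (int (k div N) + 1) q \<omega> $ (k mod N)"
        using k kb by (simp add: colvec_def data_mat_def)
      also have "\<dots> = (\<Sum>s<Q. (Phi_block A W q s *\<^sub>v X (int (k div N)) s \<omega>) $ (k mod N))
          + \<epsilon> (int (k div N) + 1) q \<omega> $ (k mod N)"
        using elim(1) kb by blast
      also have "\<epsilon> (int (k div N) + 1) q \<omega> $ (k mod N) = colvec (data_mat N T \<epsilon> q \<omega>) $ k"
        using k kb by (simp add: colvec_def data_mat_def)
      finally show "colvec (data_mat N T X q \<omega>) $ k
          = ((?x\<^sup>T \<otimes>\<^sub>K 1\<^sub>m N) *\<^sub>v colvec ?F + colvec (data_mat N T \<epsilon> q \<omega>)) $ k"
        using k by (simp add: key index_add_vec(1) dU)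
    qed (simp add: colvec_def data_mat_def kron_def design_def mult.commute)
  qed
qed

end

theory Submission
  imports Defs
begin

text \<open>For fixed restrictions \<open>B\<close> the identity $(X \otimes \Sigma^{-1})(X' \otimes I) = XX' \otimes
  \Sigma^{-1}$ makes the estimator the affine function $R(B) C \gamma + L_B u$ of the noise $u$, and
  $L_B u$ has conditional mean zero. Now $R(B) C g$ is a projection of $R(A) g$ onto the column space
  of $R(B)$, so it equals $R(A) g$ exactly when $R(A) g$ lies in that space. As the latter consists
  of the vectors supported on the nonzero entries of \<open>B\<close>, a single \<open>\<gamma>\<close> without zero entries
  already detects whether it contains the column space of $R(A)$.\<close>

section \<open>Matrix inverses and Kronecker products\<close>

text \<open>\<open>mat_inverse\<close> returns \<open>Some\<close> for every unit of the matrix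
  ring, so the work lies in turning \<open>invertible_mat\<close> into membership in
  \<open>Units\<close>.\<close>

lemma
  assumes A: "A \<in> carrier_mat n n" and inv: "invertible_mat (A :: real mat)"
  shows minv_carrier: "minv A \<in> carrier_mat n n"
    and minv_mult: "minv A * A = 1\<^sub>m n"
proof -
  obtain B where B: "A * B = 1\<^sub>m n" "B * A = 1\<^sub>m (dim_row B)"
    using inv A by (auto simp: invertible_mat_def inverts_mat_def)
  \<comment> \<open>\<open>invertible_mat\<close> does not fix the size of the witness
    \<open>B\<close>; comparing the column counts in both product equations does.\<close>
  have dimB: "dim_row B = n" "dim_col B = n"
    using arg_cong[OF B(1), of dim_col] arg_cong[OF B(2), of dim_col] A by simp_all
  then have "A \<in> Units (ring_mat TYPE(real) n ())"
    unfolding Units_def ring_mat_simps using A B by (auto intro!: bexI[of _ B])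
  then obtain C where "mat_inverse A = Some C"
    using mat_inverse(1)[OF A, of "()"] by (cases "mat_inverse A") auto
  then show "minv A \<in> carrier_mat n n" "minv A * A = 1\<^sub>m n"
    using mat_inverse(2)[OF A] by (auto simp: minv_def)
qed

lemma kron_carrier:
  assumes "A \<in> carrier_mat a b" "B \<in> carrier_mat c d"
  shows "A \<otimes>\<^sub>K B \<in> carrier_mat (a * c) (b * d)"
  using assms by (auto simp: kron_def)

text \<open>The mixed-product property: splitting the summation index into quotient and remainder
  modulo \<open>d\<close> turns each entry into a double sum that factors.\<close>

lemma kron_mult:
  assumes A: "A \<in> carrier_mat a b" and B: "B \<in> carrier_mat c d"
    and C: "C \<in> carrier_mat b e" and D: "D \<in> carrier_mat d f"
  shows "(A \<otimes>\<^sub>K B) * (C \<otimes>\<^sub>K D) = (A * C) \<otimes>\<^sub>K (B * D)"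
proof (rule eq_matI)
  note dims = carrier_matD[OF A] carrier_matD[OF B] carrier_matD[OF C] carrier_matD[OF D]
  fix i j assume "i < dim_row ((A * C) \<otimes>\<^sub>K (B * D))" "j < dim_col ((A * C) \<otimes>\<^sub>K (B * D))"
  then have i: "i < a * c" and j: "j < e * f" by (auto simp: kron_def dims)
  from i have i': "i div c < a" "i mod c < c"
    by (auto simp: less_mult_imp_div_less intro!: mod_less_divisor gr0I)
  from j have j': "j div f < e" "j mod f < f"
    by (auto simp: less_mult_imp_div_less intro!: mod_less_divisor gr0I)
  have lt: "k * d + l < b * d" if "k < b" "l < d" for k l
  proof -
    have "k * d + l < Suc k * d" using that by simp
    also have "\<dots> \<le> b * d" using that by (intro mult_right_mono) auto
    finally show ?thesis .
  qed
  have "((A \<otimes>\<^sub>K B) * (C \<otimes>\<^sub>K D)) $$ (i, j)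
      = (\<Sum>k<b * d. (A \<otimes>\<^sub>K B) $$ (i, k) * (C \<otimes>\<^sub>K D) $$ (k, j))"
    using i j by (simp add: kron_def dims scalar_prod_def lessThan_atLeast0)
  also have "\<dots> = (\<Sum>k<b. \<Sum>l<d. (A $$ (i div c, k) * C $$ (k, j div f))
      * (B $$ (i mod c, l) * D $$ (l, j mod f)))"
    unfolding sum_lessThan_mult
    by (intro sum.cong refl) (use i j lt in \<open>auto simp: kron_def dims\<close>)
  also have "\<dots> = ((A * C) \<otimes>\<^sub>K (B * D)) $$ (i, j)"
    using i j i' j' by (simp add: kron_def dims scalar_prod_def lessThan_atLeast0 sum_product)
  finally show "((A \<otimes>\<^sub>K B) * (C \<otimes>\<^sub>K D)) $$ (i, j) = ((A * C) \<otimes>\<^sub>K (B * D)) $$ (i, j)" .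
qed (use assms in \<open>auto simp: kron_def\<close>)

section \<open>Column spaces of restriction matrices\<close>

lemma restr_carrier:
  "B \<in> carrier_mat m n \<Longrightarrow> restr B \<in> carrier_mat (m * n) (nnz B)"
  by (auto simp: restr_def)

lemma colsp_mem_iff:
  "v \<in> colsp (A :: real mat) \<longleftrightarrow> (\<exists>w \<in> carrier_vec (dim_col A). A *\<^sub>v w = v)"
  by (auto simp: vec_space.col_space_eq[OF carrier_matI[OF refl refl]] intro!: carrier_vecI)

lemma colsp_subset_iff:
  "colsp (A :: real mat) \<subseteq> colsp (B :: real mat) \<longleftrightarrow>
     (\<forall>g \<in> carrier_vec (dim_col A). A *\<^sub>v g \<in> colsp B)"
  unfolding subset_iff colsp_mem_iff[of _ A] by blast

lemma restr_mult_eq_0: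
  assumes "i < dim_row B * dim_col B" "colvec B $ i = 0" "w \<in> carrier_vec (nnz B)"
  shows "(restr B *\<^sub>v w) $ i = 0"
  using assms by (simp add: restr_def scalar_prod_def)

text \<open>Rows of \<open>restr B\<close> at zero entries of \<open>B\<close> vanish; conversely a
  vector supported on the nonzero entries is rebuilt by \<open>restr_unrestr\<close>. Inclusion of
  column spaces thereby becomes inclusion of supports.\<close>

lemma colsp_restr:
  assumes B: "B \<in> binary_mats m n"
  shows "colsp (restr B)
    = {v \<in> carrier_vec (m * n). \<forall>i < m * n. colvec B $ i = 0 \<longrightarrow> v $ i = 0}" (is "_ = ?V")
proof (intro Set.set_eqI iffI)
  have dims: "dim_row B = m" "dim_col B = n" using B by (auto simp: binary_mats_def)
  have R: "restr B \<in> carrier_mat (m * n) (nnz B)" by (rule restr_carrier) (use dims in auto)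
  fix v
  show "v \<in> ?V" if v: "v \<in> colsp (restr B)"
  proof -
    obtain w where w: "w \<in> carrier_vec (nnz B)" "restr B *\<^sub>v w = v"
      using v R unfolding colsp_mem_iff by auto
    have "v \<in> carrier_vec (m * n)" using mult_mat_vec_carrier[OF R w(1)] w(2) by simp
    moreover have "v $ i = 0" if "i < m * n" "colvec B $ i = 0" for i
      using restr_mult_eq_0[of i B w] that w dims by simp
    ultimately show ?thesis by blast
  qed
  assume v: "v \<in> ?V"
  have "restr B *\<^sub>v unrestr B v = v" using v by (intro restr_unrestr[OF B]) auto
  moreover have "unrestr B v \<in> carrier_vec (dim_col (restr B))"
    using R by (intro carrier_vecI) (simp add: unrestr_def nnz_eq_length)
  ultimately show "v \<in> colsp (restr B)" unfolding colsp_mem_iff by blast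
qed

text \<open>The vector \<open>b\<close> vanishes wherever \<open>B\<close> does but nowhere on the
  support of \<open>A\<close>, so the support of \<open>A\<close> lies inside that of
  \<open>B\<close>.\<close>

lemma colsp_restr_subset_of_unrestr_nonzero:
  assumes A: "A \<in> binary_mats m n" and B: "B \<in> binary_mats m n"
    and nz: "\<forall>j < dim_vec (unrestr A b). unrestr A b $ j \<noteq> 0"
    and b: "b \<in> colsp (restr B)"
  shows "colsp (restr A) \<subseteq> colsp (restr B)"
proof -
  have dv: "dim_vec (colvec A) = m * n" using A by (auto simp: colvec_def binary_mats_def)
  have "\<forall>y \<in> set (map (\<lambda>i. b $ i) (filter (\<lambda>i. colvec A $ i \<noteq> 0) [0..<m * n])). y \<noteq> 0"
    using nz unfolding unrestr_def dv by (metis dim_vec_of_list in_set_conv_nth vec_of_list_index)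
  then have "b $ i \<noteq> 0" if "i < m * n" "colvec A $ i \<noteq> 0" for i
    using that by auto
  moreover have "b $ i = 0" if "i < m * n" "colvec B $ i = 0" for i
    using b that unfolding colsp_restr[OF B] by simp
  ultimately have "colvec A $ i = 0" if "i < m * n" "colvec B $ i = 0" for i
    using that by metis
  then show ?thesis
    unfolding colsp_restr[OF A] colsp_restr[OF B] by auto
qed

lemma finite_binary_mats: "finite (binary_mats m n)"
proof (rule finite_subset)
  let ?P = "({..<m} \<times> {..<n}) \<rightarrow>\<^sub>E {0, 1 :: real}"
  show "binary_mats m n \<subseteq> mat m n ` ?P"
  proof
    fix B assume B: "B \<in> binary_mats m n"
    \<comment> \<open>\<open>restrict\<close> makes the entry function extensional, as membership in
      \<open>?P\<close> demands.\<close>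
    then have "B = mat m n (restrict (($$) B) ({..<m} \<times> {..<n}))"
      by (intro eq_matI) (auto simp: binary_mats_def)
    moreover have "restrict (($$) B) ({..<m} \<times> {..<n}) \<in> ?P"
      using B by (auto simp: binary_mats_def)
    ultimately show "B \<in> mat m n ` ?P" by blast
  qed
  show "finite (mat m n ` ?P)" by (intro finite_imageI finite_PiE) auto
qed

section \<open>The estimator for fixed design and fixed restrictions\<close>

text \<open>The estimator is linear in the response, and this is its matrix; applied to the noise
  alone it gives the random part of the estimate.\<close>

definition noise_coeff :: "real mat \<Rightarrow> real mat \<Rightarrow> real mat \<Rightarrow> real mat" where
  "noise_coeff S x B = restr B * (minv (gram S x B) * ((restr B)\<^sup>T * (x \<otimes>\<^sub>K minv S)))"

context
  fixes S x :: "real mat" and N p T :: nat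
  assumes S: "S \<in> carrier_mat N N" "invertible_mat S" and x: "x \<in> carrier_mat p T"
begin

lemma design_kron_carrier:
  "x \<otimes>\<^sub>K minv S \<in> carrier_mat (N * p) (N * T)"
  "(x * x\<^sup>T) \<otimes>\<^sub>K minv S \<in> carrier_mat (N * p) (N * p)"
  "x\<^sup>T \<otimes>\<^sub>K 1\<^sub>m N \<in> carrier_mat (N * T) (N * p)"
proof -
  have K: "minv S \<in> carrier_mat N N" by (rule minv_carrier[OF S])
  show "x \<otimes>\<^sub>K minv S \<in> carrier_mat (N * p) (N * T)"
    "(x * x\<^sup>T) \<otimes>\<^sub>K minv S \<in> carrier_mat (N * p) (N * p)"
    "x\<^sup>T \<otimes>\<^sub>K 1\<^sub>m N \<in> carrier_mat (N * T) (N * p)"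
    using kron_carrier[OF x K] kron_carrier[OF _ K, of "x * x\<^sup>T" p p]
      kron_carrier[of "x\<^sup>T" T p "1\<^sub>m N" N N] x
    by (simp_all add: mult.commute)
qed

text \<open>Multiplying the regression design by the weighted regressors of the estimator yields the
  middle factor of both \<open>gram\<close> and \<open>C_mat\<close>.\<close>

lemma kron_normal_eq:
  "(x \<otimes>\<^sub>K minv S) * (x\<^sup>T \<otimes>\<^sub>K 1\<^sub>m N) = (x * x\<^sup>T) \<otimes>\<^sub>K minv S"
proof -
  have K: "minv S \<in> carrier_mat N N" by (rule minv_carrier[OF S])
  show ?thesis
    using kron_mult[OF x K, of "x\<^sup>T" p "1\<^sub>m N" N] x K by simp
qed

lemma gram_carrier:
  "B \<in> carrier_mat N p \<Longrightarrow> gram S x B \<in> carrier_mat (nnz B) (nnz B)"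
  unfolding gram_def using restr_carrier[of B N p] design_kron_carrier by auto

lemma minv_gram_carrier:
  "\<lbrakk>B \<in> carrier_mat N p; invertible_mat (gram S x B)\<rbrakk>
     \<Longrightarrow> minv (gram S x B) \<in> carrier_mat (nnz B) (nnz B)"
  by (intro minv_carrier gram_carrier)

lemma noise_coeff_carrier:
  "\<lbrakk>B \<in> carrier_mat N p; invertible_mat (gram S x B)\<rbrakk>
     \<Longrightarrow> noise_coeff S x B \<in> carrier_mat (N * p) (N * T)"
  unfolding noise_coeff_def
  using restr_carrier[of B N p] design_kron_carrier minv_gram_carrier[of B] by auto

context
  fixes A B :: "real mat"
  assumes A: "A \<in> carrier_mat N p" and B: "B \<in> carrier_mat N p"
    and inv: "invertible_mat (gram S x B)"
begin

text \<open>Iterated matrix-vector products are the form in which \<open>gamma_hat\<close> is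
  defined, so the two can be compared directly.\<close>

lemma C_mat_mult:
  assumes "g \<in> carrier_vec (nnz A)"
  shows "C_mat S x A B *\<^sub>v g = minv (gram S x B) *\<^sub>v
     ((restr B)\<^sup>T *\<^sub>v (((x * x\<^sup>T) \<otimes>\<^sub>K minv S) *\<^sub>v (restr A *\<^sub>v g)))"
proof -
  note c = restr_carrier[OF A] restr_carrier[OF B] design_kron_carrier
    minv_gram_carrier[OF B inv] assms
  have t: "(restr B)\<^sup>T \<in> carrier_mat (nnz B) (N * p)" using c by simp
  have m1: "(restr B)\<^sup>T * ((x * x\<^sup>T) \<otimes>\<^sub>K minv S) \<in> carrier_mat (nnz B) (N * p)"
    using t c by simp
  have m2: "(restr B)\<^sup>T * ((x * x\<^sup>T) \<otimes>\<^sub>K minv S) * restr A \<in> carrier_mat (nnz B) (nnz A)"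
    using m1 c by simp
  have Rg: "restr A *\<^sub>v g \<in> carrier_vec (N * p)" using c by simp
  show ?thesis
    unfolding C_mat_def assoc_mult_mat_vec[OF c(6) m2 c(7)]
      assoc_mult_mat_vec[OF m1 c(1) c(7)] assoc_mult_mat_vec[OF t c(4) Rg] ..
qed

lemma C_mat_mult_carrier:
  "g \<in> carrier_vec (nnz A) \<Longrightarrow> C_mat S x A B *\<^sub>v g \<in> carrier_vec (nnz B)"
  unfolding C_mat_def using carrier_matD(1)[OF minv_gram_carrier[OF B inv]]
  by (intro carrier_vecI) simp

text \<open>Signal and noise are carried separately through the successive multiplications of the
  estimator; \<open>kron_normal_eq\<close> identifies what becomes of the signal.\<close>

lemma beta_hat_regr:
  assumes g: "g \<in> carrier_vec (nnz A)" and u: "u \<in> carrier_vec (N * T)"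
  shows "beta_hat S x B (regr N x A g u)
    = restr B *\<^sub>v (C_mat S x A B *\<^sub>v g) + noise_coeff S x B *\<^sub>v u"
proof -
  let ?G = "minv (gram S x B)" and ?R = "restr B" and ?K = "x \<otimes>\<^sub>K minv S"
    and ?D = "x\<^sup>T \<otimes>\<^sub>K 1\<^sub>m N"
  note c = restr_carrier[OF A] restr_carrier[OF B] design_kron_carrier minv_gram_carrier[OF B inv]
  have t: "?R\<^sup>T \<in> carrier_mat (nnz B) (N * p)" using c by simp
  have Rg: "restr A *\<^sub>v g \<in> carrier_vec (N * p)" using c g by simp
  have DRg: "?D *\<^sub>v (restr A *\<^sub>v g) \<in> carrier_vec (N * T)" using c Rg by simp
  have KD: "?K *\<^sub>v (?D *\<^sub>v (restr A *\<^sub>v g)) = ((x * x\<^sup>T) \<otimes>\<^sub>K minv S) *\<^sub>v (restr A *\<^sub>v g)"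
    unfolding kron_normal_eq[symmetric] using c Rg by simp
  have v: "?K *\<^sub>v (?D *\<^sub>v (restr A *\<^sub>v g)) \<in> carrier_vec (N * p)" "?K *\<^sub>v u \<in> carrier_vec (N * p)"
    using c DRg u by auto
  have w: "?R\<^sup>T *\<^sub>v (?K *\<^sub>v (?D *\<^sub>v (restr A *\<^sub>v g))) \<in> carrier_vec (nnz B)"
    "?R\<^sup>T *\<^sub>v (?K *\<^sub>v u) \<in> carrier_vec (nnz B)"
    using t v by auto
  have z: "?G *\<^sub>v (?R\<^sup>T *\<^sub>v (?K *\<^sub>v (?D *\<^sub>v (restr A *\<^sub>v g)))) \<in> carrier_vec (nnz B)"
    "?G *\<^sub>v (?R\<^sup>T *\<^sub>v (?K *\<^sub>v u)) \<in> carrier_vec (nnz B)"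
    using c w by auto
  have RK: "?R\<^sup>T * ?K \<in> carrier_mat (nnz B) (N * T)" using t c by simp
  have "noise_coeff S x B *\<^sub>v u = ?R *\<^sub>v (?G *\<^sub>v (?R\<^sup>T *\<^sub>v (?K *\<^sub>v u)))"
    unfolding noise_coeff_def
    using c t RK u assoc_mult_mat_vec[OF c(2) mult_carrier_mat[OF c(6) RK] u]
      assoc_mult_mat_vec[OF c(6) RK u] assoc_mult_mat_vec[OF t c(3) u] by simp
  then show ?thesis
    unfolding beta_hat_def gamma_hat_def regr_def C_mat_mult[OF g] KD[symmetric]
      mult_add_distrib_mat_vec[OF c(3) DRg u] mult_add_distrib_mat_vec[OF t v]
      mult_add_distrib_mat_vec[OF c(6) w] mult_add_distrib_mat_vec[OF c(2) z]
    by simp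
qed

text \<open>The left-hand vector always lies in the column space of \<open>restr B\<close>.
  Conversely, if \<open>restr A *\<^sub>v g = restr B *\<^sub>v d\<close>, the Gram matrix cancels
  and \<open>C_mat S x A B *\<^sub>v g\<close> is \<open>d\<close> itself: the projection fixes its
  range.\<close>

lemma restr_C_mat_eq_iff:
  assumes g: "g \<in> carrier_vec (nnz A)"
  shows "restr B *\<^sub>v (C_mat S x A B *\<^sub>v g) = restr A *\<^sub>v g \<longleftrightarrow> restr A *\<^sub>v g \<in> colsp (restr B)"
proof
  note c = restr_carrier[OF B] design_kron_carrier(2) minv_gram_carrier[OF B inv] gram_carrier[OF B]
  show "restr A *\<^sub>v g \<in> colsp (restr B)"
    if "restr B *\<^sub>v (C_mat S x A B *\<^sub>v g) = restr A *\<^sub>v g"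
    using that C_mat_mult_carrier[OF g] c unfolding colsp_mem_iff by auto
  assume "restr A *\<^sub>v g \<in> colsp (restr B)"
  then obtain d where d: "d \<in> carrier_vec (nnz B)" "restr B *\<^sub>v d = restr A *\<^sub>v g"
    using c unfolding colsp_mem_iff by auto
  have t: "(restr B)\<^sup>T \<in> carrier_mat (nnz B) (N * p)" using c by simp
  have m1: "(restr B)\<^sup>T * ((x * x\<^sup>T) \<otimes>\<^sub>K minv S) \<in> carrier_mat (nnz B) (N * p)"
    using t c by simp
  have Rd: "restr B *\<^sub>v d \<in> carrier_vec (N * p)" by (rule mult_mat_vec_carrier[OF c(1) d(1)])
  have "(restr B)\<^sup>T *\<^sub>v (((x * x\<^sup>T) \<otimes>\<^sub>K minv S) *\<^sub>v (restr B *\<^sub>v d)) = gram S x B *\<^sub>v d"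
    unfolding gram_def assoc_mult_mat_vec[OF m1 c(1) d(1)] assoc_mult_mat_vec[OF t c(2) Rd] ..
  then have "C_mat S x A B *\<^sub>v g = minv (gram S x B) *\<^sub>v (gram S x B *\<^sub>v d)"
    unfolding C_mat_mult[OF g] d(2) by simp
  also have "\<dots> = (minv (gram S x B) * gram S x B) *\<^sub>v d"
    using assoc_mult_mat_vec[OF c(3,4) d(1)] by simp
  also have "\<dots> = d"
    using minv_mult[OF c(4) inv] d(1) by simp
  finally show "restr B *\<^sub>v (C_mat S x A B *\<^sub>v g) = restr A *\<^sub>v g" using d(2) by simp
qed

end

end

section \<open>Measurability of the estimator\<close>

lemma borel_measurable_mult_mat_vec:
  fixes K :: "real mat"
  assumes "\<And>\<omega>. v \<omega> \<in> carrier_vec d"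
    and "\<And>k. k < d \<Longrightarrow> (\<lambda>\<omega>. v \<omega> $ k) \<in> borel_measurable M"
    and "i < dim_row K"
  shows "(\<lambda>\<omega>. (K *\<^sub>v v \<omega>) $ i) \<in> borel_measurable M"
proof -
  have "(\<lambda>\<omega>. (K *\<^sub>v v \<omega>) $ i) = (\<lambda>\<omega>. \<Sum>k<d. row K i $ k * v \<omega> $ k)"
    using carrier_vecD[OF assms(1)] assms(3) by (simp add: scalar_prod_def lessThan_atLeast0)
  also have "\<dots> \<in> borel_measurable M"
    using assms(2) by (intro borel_measurable_sum borel_measurable_times) auto
  finally show ?thesis .
qed

text \<open>This has to cover every \<open>B\<close>, also one with singular Gram matrix, where
  \<open>minv\<close> is an unspecified matrix. Since \<open>scalar_prod\<close> sums over the
  length of its second argument, each stage is still a finite linear combination with constant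
  coefficients.\<close>

lemma borel_measurable_beta_hat:
  assumes "\<And>\<omega>. y \<omega> \<in> carrier_vec d"
    and "\<And>k. k < d \<Longrightarrow> (\<lambda>\<omega>. y \<omega> $ k) \<in> borel_measurable M"
    and "i < dim_row B * dim_col B"
  shows "(\<lambda>\<omega>. beta_hat S x B (y \<omega>) $ i) \<in> borel_measurable M"
proof -
  note step = borel_measurable_mult_mat_vec[OF carrier_vecI[OF dim_mult_mat_vec]]
  have "(\<lambda>\<omega>. ((x \<otimes>\<^sub>K minv S) *\<^sub>v y \<omega>) $ k) \<in> borel_measurable M"
    if "k < dim_row (x \<otimes>\<^sub>K minv S)" for k
    using assms(1,2) that by (rule borel_measurable_mult_mat_vec)
  then have "(\<lambda>\<omega>. ((restr B)\<^sup>T *\<^sub>v ((x \<otimes>\<^sub>K minv S) *\<^sub>v y \<omega>)) $ k) \<in> borel_measurable M"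
    if "k < dim_row ((restr B)\<^sup>T)" for k
    using that by (rule step)
  then have gamma: "(\<lambda>\<omega>. gamma_hat S x B (y \<omega>) $ k) \<in> borel_measurable M"
    if "k < dim_row (minv (gram S x B))" for k
    unfolding gamma_hat_def using that by (rule step)
  show ?thesis
    unfolding beta_hat_def
  proof (rule borel_measurable_mult_mat_vec[OF _ gamma])
    show "gamma_hat S x B (y \<omega>) \<in> carrier_vec (dim_row (minv (gram S x B)))" for \<omega>
      by (intro carrier_vecI) (simp add: gamma_hat_def)
  qed (use assms(3) in \<open>simp_all add: restr_def\<close>)
qed

section \<open>Conditioning on a random matrix with finitely many values\<close>

locale finite_conditioning = prob_space M for M :: "'a measure" +
  fixes \<B> :: "real mat set" and H :: "'a \<Rightarrow> real mat"
  assumes fin: "finite \<B>" and H: "H \<in> measurable M (count_space \<B>)"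
begin

definition F :: "'a measure" where
  "F = vimage_algebra (space M) H (count_space \<B>)"

lemma space_F: "space F = space M"
  by (simp add: F_def)

lemma H_F: "H \<in> measurable F (count_space \<B>)"
  unfolding F_def using H by (intro measurable_vimage_algebra1) (auto simp: measurable_def)

lemma comp_H_F: "(\<lambda>\<omega>. f (H \<omega>) :: real) \<in> borel_measurable F"
  by (rule measurable_compose[OF H_F]) simp

lemma subalgebra_F: "subalgebra M F"
  unfolding subalgebra_def space_F F_def using H
  by (auto simp: sets_vimage_algebra2 measurable_def)

sublocale finite_measure_subalgebra M F
  by unfold_locales (rule subalgebra_F)

lemma finite_sets_F: "finite (sets F)"
proof -
  have "sets F = (\<lambda>A. H -` A \<inter> space M) ` Pow \<B>"
    unfolding F_def using H by (subst sets_vimage_algebra2) (auto simp: measurable_def)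
  then show ?thesis using fin by simp
qed

text \<open>\<open>G\<close> may be uncountable: since \<open>F\<close> is finite, the intersection of all sets of \<open>F\<close> of full
  measure still has full measure.\<close>
lemma AE_uniform:
  assumes "\<And>g. g \<in> G \<Longrightarrow> AE \<omega> in M. P g \<omega>"
    and "\<And>g. g \<in> G \<Longrightarrow> {\<omega> \<in> space M. P g \<omega>} \<in> sets F"
  shows "AE \<omega> in M. \<forall>g \<in> G. P g \<omega>"
proof -
  have "AE \<omega> in M. \<forall>S \<in> {S \<in> sets F. AE \<omega> in M. \<omega> \<in> S}. \<omega> \<in> S"
    using finite_sets_F by (subst AE_ball_countable) (auto intro: countable_finite)
  then show ?thesis
  proof eventually_elim
    case (elim \<omega>)
    show ?case
    proof
      fix g assume g: "g \<in> G"
      have "AE \<omega> in M. \<omega> \<in> {\<omega> \<in> space M. P g \<omega>}"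
        using assms(1)[OF g] AE_space by eventually_elim simp
      with assms(2)[OF g] have "\<omega> \<in> {\<omega> \<in> space M. P g \<omega>}"
        by (intro bspec[OF elim] CollectI conjI)
      then show "P g \<omega>" by simp
    qed
  qed
qed

text \<open>Supplies the second premise of \<open>AE_uniform\<close>: \<open>real_cond_exp\<close>
  is \<open>F\<close>-measurable by construction, and so is every function of
  \<open>H\<close>.\<close>

lemma cond_exp_vec_eq_sets_F:
  assumes "\<And>B. B \<in> \<B> \<Longrightarrow> b B \<in> carrier_vec n"
  shows "{\<omega> \<in> space M. cond_exp_vec M \<B> H n Z \<omega> = b (H \<omega>)} \<in> sets F"
proof -
  have "{\<omega> \<in> space M. cond_exp_vec M \<B> H n Z \<omega> = b (H \<omega>)}
      = {\<omega> \<in> space F. \<forall>i<n. real_cond_exp M F (\<lambda>\<omega>. Z \<omega> $ i) \<omega> = b (H \<omega>) $ i}"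
  proof (rule Collect_cong, unfold space_F, rule conj_cong[OF refl])
    fix \<omega> assume "\<omega> \<in> space M"
    then have "b (H \<omega>) \<in> carrier_vec n" using assms H by (auto simp: measurable_def)
    then show "cond_exp_vec M \<B> H n Z \<omega> = b (H \<omega>) \<longleftrightarrow>
        (\<forall>i<n. real_cond_exp M F (\<lambda>\<omega>. Z \<omega> $ i) \<omega> = b (H \<omega>) $ i)"
      by (auto simp: cond_exp_vec_def F_def vec_eq_iff)
  qed
  also have "\<dots> \<in> sets F"
    using comp_H_F[of "\<lambda>B. b B $ _"] by measurable
  finally show ?thesis .
qed

lemma integrable_comp_H_times:
  assumes f: "integrable M f"
  shows "integrable M (\<lambda>\<omega>. c (H \<omega>) * f \<omega> :: real)"
proof (rule Bochner_Integration.integrable_bound)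
  \<comment> \<open>A function of \<open>H\<close> takes finitely many values, so the sum of their
    absolute values bounds it.\<close>
  let ?C = "\<Sum>B\<in>\<B>. \<bar>c B\<bar>"
  show "integrable M (\<lambda>\<omega>. ?C * f \<omega>)" using f by simp
  show "(\<lambda>\<omega>. c (H \<omega>) * f \<omega>) \<in> borel_measurable M"
    using f measurable_from_subalg[OF subalgebra_F comp_H_F[of c]] by auto
  show "AE \<omega> in M. norm (c (H \<omega>) * f \<omega>) \<le> norm (?C * f \<omega>)"
  proof (rule AE_I2)
    fix \<omega> assume "\<omega> \<in> space M"
    then have "\<bar>c (H \<omega>)\<bar> \<le> ?C"
      using H fin by (intro member_le_sum) (auto simp: measurable_def)
    then have "\<bar>c (H \<omega>)\<bar> * \<bar>f \<omega>\<bar> \<le> \<bar>?C\<bar> * \<bar>f \<omega>\<bar>"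
      by (intro mult_right_mono) auto
    then show "norm (c (H \<omega>) * f \<omega>) \<le> norm (?C * f \<omega>)"
      by (simp add: abs_mult)
  qed
qed

text \<open>Given \<open>H\<close>, the coefficients \<open>b (H \<omega>)\<close> and
  \<open>L (H \<omega>)\<close> are known and leave the conditional expectation, while each
  coordinate of \<open>u\<close> contributes zero.\<close>

lemma cond_exp_vec_affine:
  assumes u: "\<And>\<omega>. u \<omega> \<in> carrier_vec m" "\<And>k. k < m \<Longrightarrow> integrable M (\<lambda>\<omega>. u \<omega> $ k)"
    and zero: "AE \<omega> in M. cond_exp_vec M \<B> H m u \<omega> = 0\<^sub>v m"
    and b: "\<And>B. B \<in> \<B> \<Longrightarrow> b B \<in> carrier_vec n"
    and L: "\<And>B. B \<in> \<B> \<Longrightarrow> L B \<in> carrier_mat n m"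
    and meas: "\<And>i. i < n \<Longrightarrow> (\<lambda>\<omega>. Z \<omega> $ i) \<in> borel_measurable M"
    and Z: "AE \<omega> in M. Z \<omega> = b (H \<omega>) + L (H \<omega>) *\<^sub>v u \<omega>"
  shows "AE \<omega> in M. cond_exp_vec M \<B> H n Z \<omega> = b (H \<omega>)"
proof -
  have HB: "H \<omega> \<in> \<B>" if "\<omega> \<in> space M" for \<omega> using that H by (auto simp: measurable_def)
  have entry: "AE \<omega> in M. real_cond_exp M F (\<lambda>\<omega>. Z \<omega> $ i) \<omega> = b (H \<omega>) $ i" if i: "i < n" for i
  proof -
    \<comment> \<open>Extended by zero beyond \<open>m\<close>, because
      \<open>real_cond_exp_sum\<close> asks for integrability at every index.\<close>
    define f where "f k \<omega> = (if k < m then L (H \<omega>) $$ (i, k) * u \<omega> $ k else 0)" for k \<omega>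
    have f_int: "integrable M (f k)" for k
      using integrable_comp_H_times[OF u(2), of k "\<lambda>B. L B $$ (i, k)"]
      by (cases "k < m") (auto simp: f_def[abs_def])
    have b_int: "integrable M (\<lambda>\<omega>. b (H \<omega>) $ i)"
      using integrable_comp_H_times[of "\<lambda>_. 1" "\<lambda>B. b B $ i"] by simp
    have s_int: "integrable M (\<lambda>\<omega>. \<Sum>k<m. f k \<omega>)" using f_int by simp
    have f0: "AE \<omega> in M. real_cond_exp M F (f k) \<omega> = 0" if "k \<in> {..<m}" for k
    proof -
      have k: "k < m" using that by simp
      have "AE \<omega> in M. real_cond_exp M F (\<lambda>\<omega>. L (H \<omega>) $$ (i, k) * u \<omega> $ k) \<omega>
          = L (H \<omega>) $$ (i, k) * real_cond_exp M F (\<lambda>\<omega>. u \<omega> $ k) \<omega>"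
        using integrable_comp_H_times[OF u(2)[OF k], of "\<lambda>B. L B $$ (i, k)"] u(2)[OF k]
          comp_H_F[of "\<lambda>B. L B $$ (i, k)"]
        by (intro real_cond_exp_mult) auto
      moreover note zero
      ultimately show ?thesis
      proof eventually_elim
        case (elim \<omega>)
        from elim(2) have "cond_exp_vec M \<B> H m u \<omega> $ k = 0" using k by simp
        then show ?case
          using elim(1) k by (simp add: f_def[abs_def] cond_exp_vec_def F_def)
      qed
    qed
    have "AE \<omega> in M. Z \<omega> $ i = b (H \<omega>) $ i + (\<Sum>k<m. f k \<omega>)"
      using Z AE_space
    proof eventually_elim
      case (elim \<omega>)
      then show ?case
        using u(1)[of \<omega>] L[OF HB[OF elim(2)]] b[OF HB[OF elim(2)]] i
        by (auto simp: f_def scalar_prod_def lessThan_atLeast0)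
    qed
    then have "AE \<omega> in M. real_cond_exp M F (\<lambda>\<omega>. Z \<omega> $ i) \<omega>
        = real_cond_exp M F (\<lambda>\<omega>. b (H \<omega>) $ i + (\<Sum>k<m. f k \<omega>)) \<omega>"
      using meas[OF i] b_int s_int by (intro real_cond_exp_cong) auto
    moreover have "AE \<omega> in M. real_cond_exp M F (\<lambda>\<omega>. b (H \<omega>) $ i + (\<Sum>k<m. f k \<omega>)) \<omega>
        = real_cond_exp M F (\<lambda>\<omega>. b (H \<omega>) $ i) \<omega> + real_cond_exp M F (\<lambda>\<omega>. \<Sum>k<m. f k \<omega>) \<omega>"
      by (rule real_cond_exp_add[OF b_int s_int])
    moreover have "AE \<omega> in M. real_cond_exp M F (\<lambda>\<omega>. b (H \<omega>) $ i) \<omega> = b (H \<omega>) $ i"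
      using b_int comp_H_F[of "\<lambda>B. b B $ i"] by (rule real_cond_exp_F_meas)
    moreover have "AE \<omega> in M. real_cond_exp M F (\<lambda>\<omega>. \<Sum>k<m. f k \<omega>) \<omega>
        = (\<Sum>k<m. real_cond_exp M F (f k) \<omega>)"
      by (rule real_cond_exp_sum[OF f_int])
    moreover have "AE \<omega> in M. \<forall>k\<in>{..<m}. real_cond_exp M F (f k) \<omega> = 0"
      using f0 by (subst AE_ball_countable) auto
    ultimately show ?thesis by eventually_elim simp
  qed
  then have "AE \<omega> in M. \<forall>i\<in>{..<n}. real_cond_exp M F (\<lambda>\<omega>. Z \<omega> $ i) \<omega> = b (H \<omega>) $ i"
    by (subst AE_ball_countable) auto
  with AE_space show ?thesis
  proof eventually_elim
    case (elim \<omega>)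
    then show ?case using b[OF HB[OF elim(1)]] by (auto simp: cond_exp_vec_def F_def)
  qed
qed

end

section \<open>Integrability of the noise, and the NIRVAR estimator\<close>

text \<open>A zero expectation does not imply integrability, since the Bochner integral of a
  non-integrable function is 0. Integrability comes from the fourth moment through
  \<open>\<bar>y\<bar> \<le> 1 + \<bar>y * y * y * y\<bar>\<close>, and measurability from the
  existence of a density.\<close>

lemma (in nirvar) integrable_eps:
  assumes r: "r < Q" and i: "i < N"
  shows "integrable M (\<lambda>\<omega>. \<epsilon> t r \<omega> $ i)"
proof -
  obtain f where "distributed M (Pi\<^sub>M {..<N} (\<lambda>_. lborel)) (\<lambda>\<omega>. \<lambda>i\<in>{..<N}. \<epsilon> t r \<omega> $ i) f"
    using eps_continuous[OF r] by blast
  then have "(\<lambda>\<omega>. \<lambda>i\<in>{..<N}. \<epsilon> t r \<omega> $ i) \<in> measurable M (Pi\<^sub>M {..<N} (\<lambda>_. lborel))"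
    by (rule distributed_measurable)
  from measurable_compose[OF this measurable_component_singleton[of i]] i
  have meas: "(\<lambda>\<omega>. \<epsilon> t r \<omega> $ i) \<in> borel_measurable M" by simp
  have "integrable M (\<lambda>\<omega>. \<bar>\<epsilon> t r \<omega> $ i * \<epsilon> t r \<omega> $ i * \<epsilon> t r \<omega> $ i * \<epsilon> t r \<omega> $ i\<bar>)"
    using eps_fourth_moments[OF r] i by blast
  then have "integrable M (\<lambda>\<omega>. 1 + \<bar>\<epsilon> t r \<omega> $ i * \<epsilon> t r \<omega> $ i * \<epsilon> t r \<omega> $ i * \<epsilon> t r \<omega> $ i\<bar>)"
    by simp
  moreover have "\<bar>y\<bar> \<le> 1 + \<bar>y * y * y * y\<bar>" for y :: real
  proof (cases "\<bar>y\<bar> \<le> 1")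
    case False
    then have "\<bar>y\<bar> ^ 1 \<le> \<bar>y\<bar> ^ 4" by (intro power_increasing) auto
    then show ?thesis by (simp add: abs_mult power4_eq_xxxx)
  qed auto
  ultimately show ?thesis
    using meas by (elim Bochner_Integration.integrable_bound) auto
qed

text \<open>Unbiasedness appears in two forms: for all parameters \<open>g\<close> at once, with one
  null set for all of them, and for the model's own \<gamma> when it has no zero entry. A zero entry
  of \<gamma> could be missed by the estimated restrictions without causing any bias.\<close>

theorem proposition5p1:
  fixes M :: "'a measure" and N Q T q :: nat
    and A W :: "nat \<Rightarrow> nat \<Rightarrow> real mat"
    and X \<epsilon> :: "int \<Rightarrow> nat \<Rightarrow> 'a \<Rightarrow> real vec"
    and \<Sigma> :: "nat \<Rightarrow> real mat"
    and Ahat :: "'a \<Rightarrow> real mat" and \<omega>\<^sub>0 :: 'a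
  defines "Aq \<equiv> hconcat N Q (A q)"
    and "\<beta> \<equiv> colvec (hconcat N Q (Phi_block A W q))"
    and "\<gamma> \<equiv> unrestr (hconcat N Q (A q)) (colvec (hconcat N Q (Phi_block A W q)))"
    and "u \<equiv> \<lambda>\<omega>. colvec (data_mat N T \<epsilon> q \<omega>)"
    and "x \<equiv> design N Q T X \<omega>\<^sub>0"
    and "E_Ahat \<equiv> cond_exp_vec M (binary_mats N (N * Q)) Ahat"
    and "\<beta>hat \<equiv> \<lambda>g \<omega>. beta_hat (\<Sigma> q) (design N Q T X \<omega>\<^sub>0) (Ahat \<omega>)
           (regr N (design N Q T X \<omega>\<^sub>0) (hconcat N Q (A q)) g (colvec (data_mat N T \<epsilon> q \<omega>)))"
  assumes model: "nirvar M N Q A W X \<epsilon> \<Sigma>"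
    and q: "q < Q" and T: "0 < T"
    and \<omega>\<^sub>0: "\<omega>\<^sub>0 \<in> space M"
    and Ahat: "Ahat \<in> measurable M (count_space (binary_mats N (N * Q)))"
    and noise: "AE \<omega> in M. E_Ahat (N * T) u \<omega> = 0\<^sub>v (N * T)"
    and inv: "AE \<omega> in M. invertible_mat (gram (\<Sigma> q) x (Ahat \<omega>))"
  shows "(AE \<omega> in M.
            (\<forall>g \<in> carrier_vec (nnz Aq). E_Ahat (N * (N * Q)) (\<beta>hat g) \<omega> = restr Aq *\<^sub>v g)
            \<longleftrightarrow> colsp (restr Aq) \<subseteq> colsp (restr (Ahat \<omega>)))
    \<and> ((\<forall>j < dim_vec \<gamma>. \<gamma> $ j \<noteq> 0) \<longrightarrow>
        (AE \<omega> in M. E_Ahat (N * (N * Q)) (\<beta>hat \<gamma>) \<omega> = \<beta>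
            \<longleftrightarrow> colsp (restr Aq) \<subseteq> colsp (restr (Ahat \<omega>))))
    \<and> (AE \<omega> in M. \<not> colsp (restr Aq) \<subseteq> colsp (restr (Ahat \<omega>)) \<longrightarrow>
            E_Ahat (N * (N * Q)) (\<beta>hat \<gamma>) \<omega>
              = restr (Ahat \<omega>) *\<^sub>v (C_mat (\<Sigma> q) x Aq (Ahat \<omega>) *\<^sub>v \<gamma>))"
proof -
  interpret nirvar M N Q A W X \<epsilon> \<Sigma> by (rule model)
  interpret finite_conditioning M "binary_mats N (N * Q)" Ahat
    by unfold_locales (use finite_binary_mats Ahat in auto)
  let ?S = "\<Sigma> q"
  have S: "?S \<in> carrier_mat N N" "invertible_mat ?S"
    using Sigma_carrier[OF q] Sigma_nonsingular[OF q] by auto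
  have x: "x \<in> carrier_mat (N * Q) T" by (simp add: x_def design_def)
  have Aq_bin: "Aq \<in> binary_mats N (N * Q)"
    using A_binary[OF q] N_pos
    by (auto simp: Aq_def hconcat_def binary_mats_def less_mult_imp_div_less mult.commute)
  have carr: "B \<in> carrier_mat N (N * Q)" if "B \<in> binary_mats N (N * Q)" for B
    using that by (simp add: binary_mats_def)
  note Aq = carr[OF Aq_bin]
  have \<gamma>_eq: "\<gamma> = unrestr Aq \<beta>" by (simp add: \<gamma>_def \<beta>_def Aq_def)
  have \<gamma>: "\<gamma> \<in> carrier_vec (nnz Aq)"
    by (intro carrier_vecI) (simp add: \<gamma>_def Aq_def unrestr_def nnz_eq_length)
  have \<beta>: "restr Aq *\<^sub>v \<gamma> = \<beta>"
    unfolding Aq_def \<gamma>_def \<beta>_def by (rule beta_restricted[OF q])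
  have u: "u \<omega> \<in> carrier_vec (N * T)" for \<omega>
    by (intro carrier_vecI) (simp add: u_def colvec_def data_mat_def)
  have u_int: "integrable M (\<lambda>\<omega>. u \<omega> $ k)" if k: "k < N * T" for k
  proof -
    have "k mod N < N" "k div N < T"
      using k N_pos by (auto simp: less_mult_imp_div_less mult.commute)
    then show ?thesis
      using k integrable_eps[OF q] by (simp add: u_def colvec_def data_mat_def)
  qed
  have AhatB: "AE \<omega> in M. Ahat \<omega> \<in> binary_mats N (N * Q)"
    using Ahat by (auto simp: measurable_def)

  \<comment> \<open>The zero defaults give \<open>b\<close> and \<open>L\<close> the right
    dimensions at every binary \<open>B\<close>, as \<open>cond_exp_vec_affine\<close> requires,
    although the Gram matrix is known to be invertible only at almost every value
    \<open>Ahat \<omega>\<close>.\<close>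
  define b where "b g B = (if invertible_mat (gram ?S x B)
      then restr B *\<^sub>v (C_mat ?S x Aq B *\<^sub>v g) else 0\<^sub>v (N * (N * Q)))" for g B
  define L where "L B = (if invertible_mat (gram ?S x B)
      then noise_coeff ?S x B else 0\<^sub>m (N * (N * Q)) (N * T))" for B
  have b: "b g B \<in> carrier_vec (N * (N * Q))" if "B \<in> binary_mats N (N * Q)" for g B
    using restr_carrier[OF carr[OF that]] by (intro carrier_vecI) (simp add: b_def)
  have L: "L B \<in> carrier_mat (N * (N * Q)) (N * T)" if "B \<in> binary_mats N (N * Q)" for B
    using noise_coeff_carrier[OF S x carr[OF that]] by (auto simp: L_def)
  have E: "AE \<omega> in M. E_Ahat (N * (N * Q)) (\<beta>hat g) \<omega> = b g (Ahat \<omega>)"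
    if g: "g \<in> carrier_vec (nnz Aq)" for g
    unfolding E_Ahat_def
  proof (rule cond_exp_vec_affine[where u = u and m = "N * T" and L = L])
    show "AE \<omega> in M. cond_exp_vec M (binary_mats N (N * Q)) Ahat (N * T) u \<omega> = 0\<^sub>v (N * T)"
      using noise by (simp add: E_Ahat_def)
    show "AE \<omega> in M. \<beta>hat g \<omega> = b g (Ahat \<omega>) + L (Ahat \<omega>) *\<^sub>v u \<omega>"
      using inv AhatB
    proof eventually_elim
      case (elim \<omega>)
      then show ?case
        using beta_hat_regr[OF S x Aq carr[OF elim(2)] elim(1) g u]
        by (simp add: b_def L_def \<beta>hat_def u_def x_def Aq_def)
    qed
    fix i assume i: "i < N * (N * Q)"
    \<comment> \<open>Measurability is shown for each fixed \<open>B\<close> first; as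
      \<open>Ahat\<close> has finitely many values, it may then be substituted for
      \<open>B\<close>.\<close>
    have "(\<lambda>\<omega>. beta_hat ?S x B (regr N x Aq g (u \<omega>)) $ i) \<in> borel_measurable M"
      if "B \<in> binary_mats N (N * Q)" for B
    proof (rule borel_measurable_beta_hat[where d = "N * T"])
      show "regr N x Aq g (u \<omega>) \<in> carrier_vec (N * T)" for \<omega>
        using carrier_vecD[OF u] by (intro carrier_vecI) (simp add: regr_def)
      show "(\<lambda>\<omega>. regr N x Aq g (u \<omega>) $ k) \<in> borel_measurable M" if "k < N * T" for k
        using u_int[OF that] carrier_vecD[OF u] that by (auto simp: regr_def)
      show "i < dim_row B * dim_col B" using i carr[OF that] by auto
    qed
    then have "(\<lambda>\<omega>. beta_hat ?S x (Ahat \<omega>) (regr N x Aq g (u \<omega>)) $ i) \<in> borel_measurable M"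
      by (rule measurable_compose_countable'[OF _ Ahat])
         (auto intro: countable_finite finite_binary_mats)
    then show "(\<lambda>\<omega>. \<beta>hat g \<omega> $ i) \<in> borel_measurable M"
      by (simp add: \<beta>hat_def u_def x_def Aq_def)
  qed (use u u_int b L in auto)
  \<comment> \<open>In \<open>E\<close> the null set may depend on \<open>g\<close>, which ranges
    over an uncountable set; \<open>AE_uniform\<close> provides a common one.\<close>
  have E_all: "AE \<omega> in M. \<forall>g \<in> carrier_vec (nnz Aq).
      E_Ahat (N * (N * Q)) (\<beta>hat g) \<omega> = b g (Ahat \<omega>)"
    by (rule AE_uniform[OF E]) (use b in \<open>auto simp: E_Ahat_def intro!: cond_exp_vec_eq_sets_F\<close>)

  \<comment> \<open>Off one null set \<open>b\<close> is in its invertible branch, so the projection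
    criterion holds there for all \<open>g\<close> simultaneously.\<close>
  have key: "AE \<omega> in M. Ahat \<omega> \<in> binary_mats N (N * Q) \<and> (\<forall>g \<in> carrier_vec (nnz Aq).
      E_Ahat (N * (N * Q)) (\<beta>hat g) \<omega> = restr (Ahat \<omega>) *\<^sub>v (C_mat ?S x Aq (Ahat \<omega>) *\<^sub>v g) \<and>
      (E_Ahat (N * (N * Q)) (\<beta>hat g) \<omega> = restr Aq *\<^sub>v g
        \<longleftrightarrow> restr Aq *\<^sub>v g \<in> colsp (restr (Ahat \<omega>))))"
    using E_all inv AhatB
  proof eventually_elim
    case (elim \<omega>)
    then show ?case
      using restr_C_mat_eq_iff[OF S x Aq carr[OF elim(3)] elim(2)] by (simp add: b_def)
  qed
  have dim_restr: "dim_col (restr Aq) = nnz Aq" by (simp add: restr_def)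
  have "AE \<omega> in M. (\<forall>g \<in> carrier_vec (nnz Aq).
        E_Ahat (N * (N * Q)) (\<beta>hat g) \<omega> = restr Aq *\<^sub>v g)
      \<longleftrightarrow> colsp (restr Aq) \<subseteq> colsp (restr (Ahat \<omega>))"
    using key by eventually_elim (auto simp: colsp_subset_iff[of "restr Aq"] dim_restr)
  moreover have "AE \<omega> in M. E_Ahat (N * (N * Q)) (\<beta>hat \<gamma>) \<omega> = \<beta>
      \<longleftrightarrow> colsp (restr Aq) \<subseteq> colsp (restr (Ahat \<omega>))"
    if nz: "\<forall>j < dim_vec \<gamma>. \<gamma> $ j \<noteq> 0"
    using key
  proof eventually_elim
    case (elim \<omega>)
    \<comment> \<open>The direction that rests on \<gamma> having no zero entry: the single vector
      \<beta> then reveals the whole support of \<open>Aq\<close>.\<close>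
    have "colsp (restr Aq) \<subseteq> colsp (restr (Ahat \<omega>))" if "\<beta> \<in> colsp (restr (Ahat \<omega>))"
      using Aq_bin conjunct1[OF elim] nz[unfolded \<gamma>_eq] that
      by (rule colsp_restr_subset_of_unrestr_nonzero)
    moreover have "\<beta> \<in> colsp (restr (Ahat \<omega>))"
      if "colsp (restr Aq) \<subseteq> colsp (restr (Ahat \<omega>))"
      using bspec[OF that[unfolded colsp_subset_iff[of "restr Aq"] dim_restr] \<gamma>] unfolding \<beta> .
    moreover have "E_Ahat (N * (N * Q)) (\<beta>hat \<gamma>) \<omega> = \<beta> \<longleftrightarrow> \<beta> \<in> colsp (restr (Ahat \<omega>))"
      using bspec[OF conjunct2[OF elim] \<gamma>] unfolding \<beta> by (rule conjunct2)
    ultimately show ?case by blast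
  qed
  moreover have "AE \<omega> in M. \<not> colsp (restr Aq) \<subseteq> colsp (restr (Ahat \<omega>)) \<longrightarrow>
      E_Ahat (N * (N * Q)) (\<beta>hat \<gamma>) \<omega>
        = restr (Ahat \<omega>) *\<^sub>v (C_mat ?S x Aq (Ahat \<omega>) *\<^sub>v \<gamma>)"
    using key by eventually_elim (use \<gamma> in auto)
  ultimately show ?thesis by blast
qed

end
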